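(* Let $F:\mathbb{R}^N\to\mathbb{R}\cup\{+\infty\}$ be a proper, closed, convex function with $\operatorname{dom}(F)\subset\Lambda$, and let $c:X\times Y\to\mathbb{R}_{\ge0}$ be continuous. Then $$\min_{\lambda\in\Lambda,\ \gamma\in\Pi(\mu,\nu_\lambda)}\left(\int_{X\times Y}c\,d\gamma+F(\lambda)\right)=\sup\left\{-\int_X\varphi\,d\mu-F^*(\psi)\ :\ (\varphi,\psi)\in C(X)\times\mathbb{R}^N,\ -\varphi(x)-\psi^j\le c(x,y_j)\ \ \forall (x,y_j)\in X\times Y\right\}.$$
   Context: Fix positive integers $N,n$, a set $Y=\{y_j\}_{j=1}^N\subset\mathbb{R}^n$ of $N$ points, a compact set $X\subset\mathbb{R}^n$, and a Borel probability measure $\mu$ on $X$ with $\operatorname{spt}\mu=X$. Write $\Lambda=\{\lambda\in\mathbb{R}^N: \sum_{j=1}^N\lambda^j=1,\ \lambda^j\ge 0\}$ and, for $\lambda\in\Lambda$, $\nu_\lambda=\sum_{j=1}^N\lambda^j\delta_{y_j}$. $\Pi(\mu,\nu)$ is the set of probability measures on $X\times Y$ with left and right marginals $\mu$ and $\nu$. For convex $F$, $\operatorname{dom}(F)=\{x: F(x)<\infty\}$; proper means not identically $+\infty$; closed means lower semicontinuous. The Legendre transform of $F$ is $F^*(\psi)=\sup_{\lambda\in\mathbb{R}^N}(\langle\psi,\lambda\rangle-F(\lambda))$. *)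

theory Defs
  imports "HOL-Probability.Probability"
begin

definition prob_simplex :: "(real ^ 'm) set" where
  "prob_simplex = {lam. (\<Sum>j\<in>UNIV. lam $ j) = 1 \<and> (\<forall>j. 0 \<le> lam $ j)}"

text \<open>The topological support; the topology is the one of \<^term>\<open>space M\<close> as a subspace.\<close>

definition spt :: "'a::topological_space measure \<Rightarrow> 'a set" where
  "spt M = {x \<in> space M. \<forall>U. open U \<longrightarrow> x \<in> U \<longrightarrow> 0 < emeasure M (U \<inter> space M)}"

definition borel_prob_on :: "'a::topological_space set \<Rightarrow> 'a measure \<Rightarrow> bool" where
  "borel_prob_on S M \<longleftrightarrow> prob_space M \<and> sets M = sets (restrict_space borel S)"

text \<open>The weighted sum of Dirac measures, as a Borel measure on the finite set \<^term>\<open>range y\<close>.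
  The library has no addition of measures, hence the explicit set function;
  \<open>emeasure_nu\<close> confirms that it is indeed a measure.\<close>

definition nu :: "('m::finite \<Rightarrow> 'a::topological_space) \<Rightarrow> real ^ 'm \<Rightarrow> 'a measure" where
  "nu y lam =
     (let R = restrict_space borel (range y)
      in measure_of (space R) (sets R)
           (\<lambda>A. \<Sum>j\<in>UNIV. ennreal (lam $ j) * emeasure (return R (y j)) A))"

lemma sets_nu: "sets (nu y lam) = sets (restrict_space borel (range y))"
  by (simp add: nu_def Let_def)

lemma space_nu: "space (nu y lam) = range y"
  using sets_eq_imp_space_eq[OF sets_nu] by (simp add: space_restrict_space)

lemma emeasure_nu:
  assumes A: "A \<in> sets (restrict_space borel (range y))"
  shows "emeasure (nu y lam) A = (\<Sum>j\<in>UNIV. ennreal (lam $ j) * indicator A (y j))"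
proof -
  let ?R = "restrict_space borel (range y)"
  let ?f = "\<lambda>A. \<Sum>j\<in>UNIV. ennreal (lam $ j) * emeasure (return ?R (y j)) A"
  have "emeasure (nu y lam) A = ?f A"
  proof (rule emeasure_measure_of[where M = "nu y lam" and \<Omega> = "space ?R" and A = "sets ?R"])
    show "nu y lam = measure_of (space ?R) (sets ?R) ?f"
      by (simp add: nu_def Let_def)
    show "sets ?R \<subseteq> Pow (space ?R)"
      by (rule sets.space_closed)
    show "A \<in> sets (nu y lam)"
      using A by (simp add: sets_nu)
    show "positive (sets (nu y lam)) ?f"
      by (simp add: positive_def)
    show "countably_additive (sets (nu y lam)) ?f"
    proof (rule countably_additiveI)
      fix B :: "nat \<Rightarrow> _" assume B: "range B \<subseteq> sets (nu y lam)" "disjoint_family B"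
      have eq: "(\<Sum>i. emeasure (return ?R (y j)) (B i)) = emeasure (return ?R (y j)) (\<Union>i. B i)" for j
        using B by (intro suminf_emeasure) (auto simp: sets_nu)
      have "(\<Sum>i. ?f (B i)) = (\<Sum>j\<in>UNIV. \<Sum>i. ennreal (lam $ j) * emeasure (return ?R (y j)) (B i))"
        by (rule suminf_sum) simp
      also have "\<dots> = ?f (\<Union>i. B i)"
        by (simp only: ennreal_suminf_cmult eq)
      finally show "(\<Sum>i. ?f (B i)) = ?f (\<Union>i. B i)" .
    qed
  qed
  also have "\<dots> = (\<Sum>j\<in>UNIV. ennreal (lam $ j) * indicator A (y j))"
    using A by simp
  finally show ?thesis .
qed

definition couplings ::
  "'a::topological_space measure \<Rightarrow> 'b::topological_space measure \<Rightarrow> ('a \<times> 'b) measure set" where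
  "couplings M N = {\<gamma>. borel_prob_on (space M \<times> space N) \<gamma> \<and>
     distr \<gamma> M fst = M \<and> distr \<gamma> N snd = N}"

definition eff_dom :: "('a \<Rightarrow> ereal) \<Rightarrow> 'a set" where
  "eff_dom F = {x. F x < \<infinity>}"

definition proper_fun :: "('a \<Rightarrow> ereal) \<Rightarrow> bool" where
  "proper_fun F \<longleftrightarrow> \<not> (\<forall>x. F x = \<infinity>)"

definition closed_fun :: "('a::topological_space \<Rightarrow> ereal) \<Rightarrow> bool" where
  "closed_fun F \<longleftrightarrow> (\<forall>x. F x \<le> Liminf (at x) F)"

text \<open>Intended for functions that never take the value \<open>-\<infinity>\<close>; the convention \<open>0 * \<infinity> = 0\<close>
  of \<^typ>\<open>ereal\<close> makes the boundary cases of the weights harmless.\<close>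

definition convex_fun :: "('a::real_vector \<Rightarrow> ereal) \<Rightarrow> bool" where
  "convex_fun F \<longleftrightarrow> (\<forall>x y. \<forall>u\<ge>0. \<forall>v\<ge>0. u + v = 1 \<longrightarrow>
     F (u *\<^sub>R x + v *\<^sub>R y) \<le> ereal u * F x + ereal v * F y)"

definition legendre :: "('a::real_inner \<Rightarrow> ereal) \<Rightarrow> 'a \<Rightarrow> ereal" where
  "legendre F \<psi> = (SUP lam. ereal (\<psi> \<bullet> lam) - F lam)"

definition primal_feasible ::
  "'a::topological_space measure \<Rightarrow> ('m::finite \<Rightarrow> 'b::topological_space)
    \<Rightarrow> ((real ^ 'm) \<times> ('a \<times> 'b) measure) set" where
  "primal_feasible \<mu> y = {(lam, \<gamma>). lam \<in> prob_simplex \<and> \<gamma> \<in> couplings \<mu> (nu y lam)}"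

definition primal_cost ::
  "('a \<times> 'b \<Rightarrow> real) \<Rightarrow> (real ^ 'm \<Rightarrow> ereal) \<Rightarrow> (real ^ 'm) \<times> ('a \<times> 'b) measure \<Rightarrow> ereal" where
  "primal_cost c F = (\<lambda>(lam, \<gamma>). ereal (\<integral>z. c z \<partial>\<gamma>) + F lam)"

definition dual_feasible ::
  "'a::topological_space set \<Rightarrow> ('m \<Rightarrow> 'b) \<Rightarrow> ('a \<times> 'b \<Rightarrow> real)
    \<Rightarrow> (('a \<Rightarrow> real) \<times> (real ^ 'm)) set" where
  "dual_feasible X y c = {(\<phi>, \<psi>). continuous_on X \<phi> \<and>
     (\<forall>x\<in>X. \<forall>j. - \<phi> x - \<psi> $ j \<le> c (x, y j))}"

definition dual_value ::
  "'a measure \<Rightarrow> (real ^ 'm \<Rightarrow> ereal) \<Rightarrow> ('a \<Rightarrow> real) \<times> (real ^ 'm) \<Rightarrow> ereal" where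
  "dual_value \<mu> F = (\<lambda>(\<phi>, \<psi>). ereal (- (\<integral>x. \<phi> x \<partial>\<mu>)) - legendre F \<psi>)"

end

theory Submission
  imports Defs
begin

text \<open>Since the target is the finite set \<open>range y\<close>, a plan can be described by how each point \<open>x\<close>
splits its mass among the indices: a measurable function \<open>f\<close> from \<open>X\<close> to the simplex, here
called a selection. With \<open>C x = (c (x, y j))\<^sub>j\<close> its transport cost is \<open>\<integral> C x \<bullet> f x\<close> and its
second marginal has the weights \<open>\<integral> f\<close>, so the primal problem becomes the minimisation of
\<open>J f = \<integral> C x \<bullet> f x + F (\<integral> f)\<close>. The proof exhibits one selection whose \<open>J\<close> is at most the dual
supremum \<open>d\<close>; weak duality (\<open>weak_duality\<close>), which compares an arbitrary coupling with an
arbitrary dual pair, then yields at once that this selection is optimal among all couplings and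
that there is no gap.

The inequality \<open>J f \<le> d\<close> is Fenchel duality in \<open>\<real>\<^sup>N\<close>. The values
\<open>(lam - \<integral> f, \<integral> C x \<bullet> f x + t)\<close>, with \<open>F lam \<le> t\<close> and \<open>f\<close> a selection, form a convex
set \<open>D\<close>. If \<open>(0, T)\<close> is not in its closure, a separating hyperplane gives a dual pair of value
at least \<open>T\<close> (\<open>separation_multiplier\<close>). The hyperplane cannot be vertical, because every point
of the domain of \<open>F\<close> lies in the simplex and hence is the integral of a constant selection.
The best \<open>\<phi>\<close> for a given \<open>\<psi>\<close> is \<open>- min\<^sub>j (c (x, y j) + \<psi>\<^sub>j)\<close>,
and that minimum is attained by a selection (\<open>argmin_selection\<close>).

Hence \<open>(0, T)\<close> lies in the closure of \<open>D\<close> for every \<open>T > d\<close>, and it remains to see that such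
approximate values are attained (\<open>approximate_values_attained\<close>). This rests on
convexity: in a decreasing sequence of bounded convex sets of functions,
choosing elements of almost minimal \<open>L\<^sup>2\<close> norm gives a Cauchy sequence by the parallelogram law, and so one that
converges almost everywhere along a subsequence (\<open>nested_midpoint_convex_AE_convergent\<close>).
Dominated convergence and the lower semicontinuity of \<open>F\<close> do the rest.\<close>

section \<open>Almost everywhere limits from nested convex sets of functions\<close>

text \<open>Let \<open>d k\<close> be the infimum of \<open>\<integral> \<bar>f\<bar>\<^sup>2\<close> over \<open>S k\<close>; it increases and is bounded, hence it
converges. For almost minimal elements \<open>f k\<close> and \<open>f l\<close> with \<open>k \<le> l\<close> the midpoint belongs to
\<open>S k\<close>, so its squared norm is at least \<open>d k\<close>, and the parallelogram law bounds the squared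
distance of \<open>f k\<close> and \<open>f l\<close> by about \<open>2 (d l - d k)\<close>.\<close>

lemma nested_midpoint_convex_AE_convergent:
  fixes S :: "nat \<Rightarrow> ('a \<Rightarrow> 'b::euclidean_space) set"
  assumes M: "prob_space M"
    and nonempty: "\<And>k. S k \<noteq> {}"
    and nested: "decseq S"
    and meas: "\<And>f. f \<in> S 0 \<Longrightarrow> f \<in> borel_measurable M"
    and bound: "\<And>f x. f \<in> S 0 \<Longrightarrow> x \<in> space M \<Longrightarrow> norm (f x) \<le> B"
    and midpoint: "\<And>k f g. f \<in> S k \<Longrightarrow> g \<in> S k \<Longrightarrow> (\<lambda>x. (1/2) *\<^sub>R f x + (1/2) *\<^sub>R g x) \<in> S k"
  obtains g where "\<And>k. g k \<in> S k" "AE x in M. convergent (\<lambda>k. g k x)"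
proof -
  interpret prob_space M by (fact M)
  have sub0: "f \<in> S 0" if "f \<in> S k" for f k
    using nested that by (auto simp: decseq_def)
  define Q where "Q f = (\<integral>x. (norm (f x))\<^sup>2 \<partial>M)" for f :: "'a \<Rightarrow> 'b"
  define d where "d k = (INF f\<in>S k. Q f)" for k
  have intS: "integrable M f" "integrable M (\<lambda>x. (norm (f x))\<^sup>2)" if "f \<in> S 0" for f
  proof -
    show "integrable M f"
      using meas[OF that] bound[OF that] by (intro integrable_const_bound[where B=B]) auto
    show "integrable M (\<lambda>x. (norm (f x))\<^sup>2)"
      using meas[OF that] bound[OF that]
      by (intro integrable_const_bound[where B="B\<^sup>2"]) (auto intro!: power_mono)
  qed
  have Q0: "0 \<le> Q f" for f by (auto simp: Q_def)
  have QB: "Q f \<le> B\<^sup>2" if "f \<in> S 0" for f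
  proof -
    have "Q f \<le> (\<integral>x. B\<^sup>2 \<partial>M)" unfolding Q_def
      using intS(2)[OF that] bound[OF that] by (intro integral_mono) (auto intro!: power_mono)
    then show ?thesis by (simp add: prob_space)
  qed
  have bdd: "bdd_below (Q ` S k)" for k using Q0 by (auto intro!: bdd_belowI[of _ 0])
  have d_le: "d k \<le> Q f" if "f \<in> S k" for f k
    unfolding d_def using that bdd by (rule cINF_lower[rotated])
  have d_mono: "d k \<le> d l" if "k \<le> l" for k l
    unfolding d_def using nonempty bdd nested that
    by (intro cINF_superset_mono) (auto simp: decseq_def)
  have "incseq d" using d_mono by (auto simp: incseq_def)
  moreover have "d k \<le> B\<^sup>2" for k
    using nonempty[of k] d_le[of _ k] QB sub0 by (metis all_not_in_conv order_trans)
  ultimately obtain L where L: "d \<longlonglongrightarrow> L" using incseq_convergent[of d "B\<^sup>2"] by blast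
  define \<epsilon> where "\<epsilon> k = 1 / real (Suc k)" for k
  have \<epsilon>_pos: "0 < \<epsilon> k" for k by (simp add: \<epsilon>_def)
  have \<epsilon>_mono: "\<epsilon> l \<le> \<epsilon> k" if "k \<le> l" for k l
    using that by (simp add: \<epsilon>_def frac_le)
  have "\<exists>f\<in>S k. Q f < d k + \<epsilon> k" for k
    using cINF_less_iff[OF nonempty bdd, of k "d k + \<epsilon> k"] \<epsilon>_pos[of k] unfolding d_def by simp
  then obtain f where fS: "\<And>k. f k \<in> S k" and fQ: "\<And>k. Q (f k) < d k + \<epsilon> k"
    by metis
  have f0: "f k \<in> S 0" for k using fS sub0 by blast
  have para: "(\<integral>x. (norm (f k x - f l x))\<^sup>2 \<partial>M) \<le> 2 * (d l - d k) + 4 * \<epsilon> k"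
    and intd: "integrable M (\<lambda>x. (norm (f k x - f l x))\<^sup>2)" if "k \<le> l" for k l
  proof -
    define m where "m x = (1/2) *\<^sub>R f k x + (1/2) *\<^sub>R f l x" for x
    have "f l \<in> S k" using fS[of l] nested that by (auto simp: decseq_def)
    then have mS: "m \<in> S k" unfolding m_def[abs_def] using fS by (intro midpoint)
    have eq: "(norm (f k x - f l x))\<^sup>2
        = 2 * (norm (f k x))\<^sup>2 + 2 * (norm (f l x))\<^sup>2 - 4 * (norm (m x))\<^sup>2" for x
      by (simp add: m_def power2_norm_eq_inner inner_commute algebra_simps)
    show "integrable M (\<lambda>x. (norm (f k x - f l x))\<^sup>2)"
      unfolding eq using intS(2)[OF f0[of k]] intS(2)[OF f0[of l]] intS(2)[OF sub0[OF mS]] by auto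
    have "(\<integral>x. (norm (f k x - f l x))\<^sup>2 \<partial>M) = 2 * Q (f k) + 2 * Q (f l) - 4 * Q m"
      unfolding eq Q_def using intS(2)[OF f0[of k]] intS(2)[OF f0[of l]] intS(2)[OF sub0[OF mS]]
      by simp
    also have "\<dots> \<le> 2 * (d k + \<epsilon> k) + 2 * (d l + \<epsilon> l) - 4 * d k"
      using fQ[of k] fQ[of l] d_le[OF mS] by (smt (verit))
    also have "\<dots> \<le> 2 * (d l - d k) + 4 * \<epsilon> k"
      using \<epsilon>_mono[OF that] by (smt (verit))
    finally show "(\<integral>x. (norm (f k x - f l x))\<^sup>2 \<partial>M) \<le> 2 * (d l - d k) + 4 * \<epsilon> k" .
  qed
  have small: "\<exists>N. \<forall>k\<ge>N. \<forall>l\<ge>N. (\<integral>x. norm (f k x - f l x) \<partial>M) < e" if e: "0 < e" for e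
  proof -
    have "(\<lambda>k. 2 * (L - d k) + 4 * \<epsilon> k) \<longlonglongrightarrow> 2 * (L - L) + 4 * 0"
      using LIMSEQ_Suc[OF lim_1_over_n] L unfolding \<epsilon>_def by (intro tendsto_intros)
    then have "eventually (\<lambda>k. 2 * (L - d k) + 4 * \<epsilon> k < e\<^sup>2) sequentially"
      using e by (intro order_tendstoD(2)) auto
    then obtain N where N: "\<And>k. k \<ge> N \<Longrightarrow> 2 * (L - d k) + 4 * \<epsilon> k < e\<^sup>2"
      by (auto simp: eventually_sequentially)
    have dL: "d l \<le> L" for l using incseq_le[OF \<open>incseq d\<close> L] .
    have main: "(\<integral>x. norm (f k x - f l x) \<partial>M) < e" if "N \<le> k" "k \<le> l" for k l
    proof -
      have int2: "(\<integral>x. (norm (f k x - f l x))\<^sup>2 \<partial>M) < e\<^sup>2"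
        using para[OF that(2)] N[OF that(1)] dL[of l] by (smt (verit))
      \<comment> \<open>The arithmetic-geometric mean inequality leads from \<open>L\<^sup>2\<close> to \<open>L\<^sup>1\<close>.\<close>
      have "t \<le> (1/2) * e + (1 / (2*e)) * t\<^sup>2" for t :: real
        using e sum_squares_bound[of t e] by (simp add: field_simps power2_eq_square)
      then have "(\<integral>x. norm (f k x - f l x) \<partial>M)
          \<le> (\<integral>x. (1/2) * e + (1 / (2*e)) * (norm (f k x - f l x))\<^sup>2 \<partial>M)"
        using intd[OF that(2)] intS(1)[OF f0[of k]] intS(1)[OF f0[of l]]
        by (intro integral_mono) auto
      also have "\<dots> = (1/2) * e + (1 / (2*e)) * (\<integral>x. (norm (f k x - f l x))\<^sup>2 \<partial>M)"
        using intd[OF that(2)] by (simp add: prob_space)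
      also have "\<dots> < (1/2) * e + (1 / (2*e)) * e\<^sup>2"
        using int2 e by (intro add_strict_left_mono mult_strict_left_mono) auto
      also have "\<dots> = e" using e by (simp add: power2_eq_square)
      finally show ?thesis .
    qed
    show ?thesis
    proof (intro exI allI impI)
      fix k l assume "N \<le> k" "N \<le> l"
      then show "(\<integral>x. norm (f k x - f l x) \<partial>M) < e"
        using main[of k l] main[of l k] by (cases "k \<le> l") (auto simp: norm_minus_commute)
    qed
  qed
  obtain r where r: "strict_mono r" "AE x in M. Cauchy (\<lambda>i. f (r i) x)"
    using cauchy_L1_AE_cauchy_subseq[of M f] intS(1)[OF f0] small by blast
  show ?thesis
  proof (rule that)
    show "(f \<circ> r) k \<in> S k" for k
      using fS[of "r k"] nested seq_suble[OF r(1), of k] by (auto simp: decseq_def)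
    show "AE x in M. convergent (\<lambda>k. (f \<circ> r) k x)"
      using r(2) by (auto simp: Cauchy_convergent_iff)
  qed
qed

section \<open>Selections of the simplex\<close>

lemma borel_measurable_vec_nth:
  fixes f :: "'a \<Rightarrow> real ^ 'm"
  shows "f \<in> borel_measurable M \<Longrightarrow> (\<lambda>x. f x $ j) \<in> borel_measurable M"
  by (rule borel_measurable_continuous_on[of "\<lambda>v. v $ j"]) (auto intro: continuous_intros)

definition selections :: "'a measure \<Rightarrow> ('a \<Rightarrow> real ^ 'm) set" where
  "selections M = {f \<in> borel_measurable M. \<forall>x\<in>space M. f x \<in> prob_simplex}"

lemma convex_prob_simplex: "convex prob_simplex"
  unfolding convex_def prob_simplex_def
  by (auto simp: sum.distrib sum_distrib_left[symmetric])

lemma norm_prob_simplex_le: "lam \<in> prob_simplex \<Longrightarrow> norm lam \<le> 1"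
  using norm_le_l1_cart[of lam] by (auto simp: prob_simplex_def)

lemma const_selection: "lam \<in> prob_simplex \<Longrightarrow> (\<lambda>x. lam) \<in> selections M"
  by (auto simp: selections_def)

lemma convex_combination_selection:
  assumes "f \<in> selections M" "g \<in> selections M" "0 \<le> u" "0 \<le> v" "u + v = 1"
  shows "(\<lambda>x. u *\<^sub>R f x + v *\<^sub>R g x) \<in> selections M"
  using assms convexD[OF convex_prob_simplex, of _ _ u v] by (auto simp: selections_def)

lemma (in prob_space) integrable_selection:
  assumes "f \<in> selections M"
  shows "integrable M f"
  using assms norm_prob_simplex_le
  by (intro integrable_const_bound[where B=1]) (auto simp: selections_def)

lemma (in prob_space)
  assumes f: "f \<in> selections M"
  shows integrable_selection_nth: "integrable M (\<lambda>x. f x $ j)"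
    and integral_selection_nth: "(\<integral>x. f x \<partial>M) $ j = (\<integral>x. f x $ j \<partial>M)"
  using integrable_bounded_linear[OF bounded_linear_vec_nth integrable_selection[OF f]]
    integral_bounded_linear[OF bounded_linear_vec_nth integrable_selection[OF f]] by auto

lemma (in prob_space) integral_selection_in_simplex:
  assumes f: "f \<in> selections M"
  shows "(\<integral>x. f x \<partial>M) \<in> prob_simplex"
proof -
  have "(\<Sum>j\<in>UNIV. \<integral>x. f x $ j \<partial>M) = (\<integral>x. (\<Sum>j\<in>UNIV. f x $ j) \<partial>M)"
    using integrable_selection_nth[OF f] by simp
  also have "\<dots> = (\<integral>x. 1 \<partial>M)"
    using f by (intro Bochner_Integration.integral_cong) (auto simp: selections_def prob_simplex_def)
  finally show ?thesis
    using f
    by (auto simp: prob_simplex_def integral_selection_nth[OF f] selections_def prob_space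
        intro!: integral_nonneg_AE)
qed

lemma norm_inner_selection_le:
  assumes f: "f \<in> selections M" and x: "x \<in> space M" and C: "norm (C x) \<le> B"
  shows "norm (C x \<bullet> f x) \<le> B"
proof -
  have "norm (f x) \<le> 1" using f x norm_prob_simplex_le by (auto simp: selections_def)
  then have "norm (C x) * norm (f x) \<le> B * 1"
    using C by (intro mult_mono) (auto intro: order_trans[OF norm_ge_zero])
  then show ?thesis using Cauchy_Schwarz_ineq2[of "C x" "f x"] by simp
qed

lemma (in prob_space) integrable_inner_selection:
  fixes C :: "'a \<Rightarrow> real ^ 'm"
  assumes f: "f \<in> selections M"
    and C: "C \<in> borel_measurable M" "\<And>x. x \<in> space M \<Longrightarrow> norm (C x) \<le> B"
  shows "integrable M (\<lambda>x. C x \<bullet> f x)"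
  using f C norm_inner_selection_le[OF f]
  by (intro integrable_const_bound[where B=B]) (auto simp: selections_def)

text \<open>Sharing the mass equally among all minimising indices avoids an ordering of the index type: the
weights are quotients of measurable functions.\<close>

lemma argmin_selection:
  fixes C :: "'a \<Rightarrow> real ^ 'm"
  assumes C: "C \<in> borel_measurable M"
  obtains f where "f \<in> selections M" "\<And>x. C x \<bullet> f x = (MIN j. C x $ j)"
proof -
  define m where "m x = (MIN j. C x $ j)" for x
  define card_min where "card_min x = (\<Sum>j\<in>UNIV. if C x $ j = m x then 1 else 0 :: real)" for x
  define w where "w j x = (if C x $ j = m x then 1 / card_min x else 0)" for j x
  define f :: "'a \<Rightarrow> real ^ 'm" where "f x = (\<Sum>j\<in>UNIV. w j x *\<^sub>R axis j 1)" for x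
  have f_nth: "f x $ j = w j x" for x j
    by (simp add: f_def axis_def if_distrib cong: if_cong)
  have card_pos: "0 < card_min x" for x
  proof -
    have "m x \<in> range (\<lambda>j. C x $ j)" unfolding m_def by (rule Min_in) auto
    then obtain j where "C x $ j = m x" by force
    then show ?thesis unfolding card_min_def by (intro sum_pos2[of _ j]) auto
  qed
  have sum_w: "(\<Sum>j\<in>UNIV. w j x) = 1" for x
  proof -
    have "(\<Sum>j\<in>UNIV. w j x) = (\<Sum>j\<in>UNIV. if C x $ j = m x then 1 else 0) / card_min x"
      unfolding w_def sum_divide_distrib by (intro sum.cong) auto
    then show ?thesis using card_pos[of x] by (simp add: card_min_def)
  qed
  have C_nth: "(\<lambda>x. C x $ j) \<in> borel_measurable M" for j
    using C by (rule borel_measurable_vec_nth)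
  have "m \<in> borel_measurable M"
    unfolding m_def using C_nth by (intro borel_measurable_Min) auto
  note [measurable] = this C_nth
  have "f \<in> borel_measurable M"
    unfolding f_def w_def card_min_def by measurable
  moreover have "f x \<in> prob_simplex" for x
    using card_pos[of x] sum_w[of x] by (simp add: prob_simplex_def f_nth) (simp add: w_def)
  ultimately have "f \<in> selections M" by (simp add: selections_def)
  moreover have "C x \<bullet> f x = (MIN j. C x $ j)" for x
  proof -
    have "C x \<bullet> f x = (\<Sum>j\<in>UNIV. m x * w j x)"
      unfolding inner_vec_def f_nth by (intro sum.cong) (auto simp: w_def)
    also have "\<dots> = m x" by (simp add: sum_distrib_left[symmetric] sum_w)
    finally show ?thesis by (simp add: m_def)
  qed
  ultimately show ?thesis using that by blast
qed

section \<open>The perturbed primal problem\<close>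

text \<open>The first component measures by how much the constraint \<open>lam = \<integral> f\<close> is violated, the second is
an upper bound of the objective. Over all selections these sets unite to the epigraph, up to
attainment of infima, of the perturbation function of Fenchel duality.\<close>

definition perturbed_values ::
  "'a measure \<Rightarrow> ('a \<Rightarrow> real ^ 'm) \<Rightarrow> (real ^ 'm \<Rightarrow> ereal) \<Rightarrow> ('a \<Rightarrow> real ^ 'm) \<Rightarrow> ((real ^ 'm) \<times> real) set"
  where "perturbed_values M C F f =
    {(lam - (\<integral>x. f x \<partial>M), (\<integral>x. C x \<bullet> f x \<partial>M) + t) | lam t. F lam \<le> ereal t}"

lemma (in prob_space) perturbed_values_convex_combination:
  fixes C :: "'a \<Rightarrow> real ^ 'm"
  assumes C: "C \<in> borel_measurable M" "\<And>x. x \<in> space M \<Longrightarrow> norm (C x) \<le> B"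
    and F: "convex_fun F"
    and f: "f \<in> selections M" "p \<in> perturbed_values M C F f"
    and g: "g \<in> selections M" "q \<in> perturbed_values M C F g"
    and uv: "0 \<le> u" "0 \<le> v" "u + v = 1"
  shows "u *\<^sub>R p + v *\<^sub>R q \<in> perturbed_values M C F (\<lambda>x. u *\<^sub>R f x + v *\<^sub>R g x)"
proof -
  obtain lam t where p: "p = (lam - (\<integral>x. f x \<partial>M), (\<integral>x. C x \<bullet> f x \<partial>M) + t)" "F lam \<le> ereal t"
    using f(2) by (auto simp: perturbed_values_def)
  obtain lam' t' where q: "q = (lam' - (\<integral>x. g x \<partial>M), (\<integral>x. C x \<bullet> g x \<partial>M) + t')" "F lam' \<le> ereal t'"
    using g(2) by (auto simp: perturbed_values_def)
  have "F (u *\<^sub>R lam + v *\<^sub>R lam') \<le> ereal u * F lam + ereal v * F lam'"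
    using F uv by (auto simp: convex_fun_def)
  also have "\<dots> \<le> ereal u * ereal t + ereal v * ereal t'"
    using p(2) q(2) uv by (intro add_mono ereal_mult_left_mono) auto
  finally have "F (u *\<^sub>R lam + v *\<^sub>R lam') \<le> ereal (u * t + v * t')" by simp
  moreover have "(\<integral>x. u *\<^sub>R f x + v *\<^sub>R g x \<partial>M) = u *\<^sub>R (\<integral>x. f x \<partial>M) + v *\<^sub>R (\<integral>x. g x \<partial>M)"
    using integrable_selection[OF f(1)] integrable_selection[OF g(1)] by simp
  moreover have "(\<integral>x. C x \<bullet> (u *\<^sub>R f x + v *\<^sub>R g x) \<partial>M)
      = u * (\<integral>x. C x \<bullet> f x \<partial>M) + v * (\<integral>x. C x \<bullet> g x \<partial>M)"
    using integrable_inner_selection[OF f(1) C] integrable_inner_selection[OF g(1) C]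
    by (simp add: inner_add_right)
  ultimately show ?thesis
    unfolding perturbed_values_def p(1) q(1)
    by (intro CollectI exI[of _ "u *\<^sub>R lam + v *\<^sub>R lam'"] exI[of _ "u * t + v * t'"])
       (simp add: algebra_simps)
qed

lemma closed_fun_eventually_gt:
  assumes "closed_fun F" "a < F x"
  shows "eventually (\<lambda>z. a < F z) (nhds x)"
proof -
  have "eventually (\<lambda>z. a < F z) (at x)"
    using assms unfolding closed_fun_def le_Liminf_iff by blast
  then show ?thesis using assms(2) by (auto simp: eventually_nhds_conv_at)
qed

text \<open>The selections that meet the \<open>k\<close>-th tolerance form a decreasing sequence of convex sets, so some
choice \<open>g k\<close> from them converges almost everywhere. The constraint violation vanishes in the limit,
the integrals converge by dominated convergence, and \<open>F\<close> is lower semicontinuous. A decreasing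
sequence of bounds, rather than its limit, lets the same statement cover a limit \<open>- \<infinity>\<close>.\<close>

lemma (in prob_space) approximate_values_attained:
  fixes C :: "'a \<Rightarrow> real ^ 'm" and T :: "nat \<Rightarrow> real"
  assumes C: "C \<in> borel_measurable M" "\<And>x. x \<in> space M \<Longrightarrow> norm (C x) \<le> B"
    and F: "closed_fun F" "convex_fun F"
    and T: "decseq T"
    and approx: "\<And>k. \<exists>f\<in>selections M. \<exists>(z, r)\<in>perturbed_values M C F f.
                   norm z \<le> 1 / real (Suc k) \<and> r \<le> T k"
  obtains f where "f \<in> selections M"
    "\<And>k. ereal (\<integral>x. C x \<bullet> f x \<partial>M) + F (\<integral>x. f x \<partial>M) \<le> ereal (T k)"
proof -
  define E where "E k = cball (0 :: real ^ 'm) (1 / real (Suc k)) \<times> {..T k}" for k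
  have E: "convex (E k)" for k
    unfolding E_def by (intro convex_Times convex_cball convex_real_interval)
  have E_mono: "E l \<subseteq> E k" if "k \<le> l" for k l
    using T that frac_le[of 1 1 "real (Suc k)" "real (Suc l)"]
    unfolding E_def decseq_def
    by (intro Sigma_mono subset_cball) auto
  define S where "S k = {f \<in> selections M. perturbed_values M C F f \<inter> E k \<noteq> {}}" for k
  have S0: "f \<in> selections M" if "f \<in> S k" for f k using that by (auto simp: S_def)
  obtain g where gS: "\<And>k. g k \<in> S k" and conv: "AE x in M. convergent (\<lambda>k. g k x)"
  proof (rule nested_midpoint_convex_AE_convergent[of M S 1])
    show "prob_space M" by unfold_locales
    show "S k \<noteq> {}" for k
      using approx[of k] by (fastforce simp: S_def E_def)
    show "decseq S" using E_mono by (fastforce simp: decseq_def S_def)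
    show "f \<in> borel_measurable M" if "f \<in> S 0" for f
      using S0[OF that] by (simp add: selections_def)
    show "norm (f x) \<le> 1" if "f \<in> S 0" "x \<in> space M" for f x
      using S0[OF that(1)] that(2) norm_prob_simplex_le by (auto simp: selections_def)
    show "(\<lambda>x. (1/2) *\<^sub>R f x + (1/2) *\<^sub>R g x) \<in> S k" if fg: "f \<in> S k" "g \<in> S k" for k f g
    proof -
      obtain p q where p: "p \<in> perturbed_values M C F f" "p \<in> E k"
        and q: "q \<in> perturbed_values M C F g" "q \<in> E k"
        using fg by (auto simp: S_def)
      have "(1/2) *\<^sub>R p + (1/2) *\<^sub>R q \<in> perturbed_values M C F (\<lambda>x. (1/2) *\<^sub>R f x + (1/2) *\<^sub>R g x)"
        by (rule perturbed_values_convex_combination[OF C F(2) S0[OF fg(1)] p(1) S0[OF fg(2)] q(1)]) auto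
      moreover have "(1/2) *\<^sub>R p + (1/2) *\<^sub>R q \<in> E k"
        by (rule convexD[OF E p(2) q(2)]) auto
      moreover have "(\<lambda>x. (1/2) *\<^sub>R f x + (1/2) *\<^sub>R g x) \<in> selections M"
        by (rule convex_combination_selection[OF S0[OF fg(1)] S0[OF fg(2)]]) auto
      ultimately show ?thesis by (auto simp: S_def)
    qed
  qed (use that in blast)
  have g: "g k \<in> selections M" for k using gS S0 by blast
  have gm: "g k \<in> borel_measurable M" for k using g by (auto simp: selections_def)
  have closed_simplex: "closed (prob_simplex :: (real ^ 'm) set)"
    unfolding prob_simplex_def
    by (intro closed_Collect_conj closed_Collect_eq closed_Collect_all closed_Collect_le
          continuous_intros)
  obtain s :: "real ^ 'm" where s: "s \<in> prob_simplex"
    using g[of 0] not_empty by (auto simp: selections_def)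
  \<comment> \<open>Where the sequence does not converge, any fixed point of the simplex will do.\<close>
  define f where "f x = (if convergent (\<lambda>k. g k x) then lim (\<lambda>k. g k x) else s)" for x
  have f_simplex: "f x \<in> prob_simplex" if x: "x \<in> space M" for x
  proof (cases "convergent (\<lambda>k. g k x)")
    case True
    then have lim: "(\<lambda>k. g k x) \<longlonglongrightarrow> f x" by (simp add: f_def convergent_LIMSEQ_iff)
    have "g k x \<in> prob_simplex" for k using g x by (auto simp: selections_def)
    then show ?thesis using closed_sequentially[OF closed_simplex _ lim] by blast
  qed (simp add: f_def s)
  have f_meas: "f \<in> borel_measurable M"
    unfolding f_def Cauchy_convergent_iff[symmetric] using gm by measurable
  have f: "f \<in> selections M" using f_meas f_simplex by (auto simp: selections_def)
  have lim: "AE x in M. (\<lambda>k. g k x) \<longlonglongrightarrow> f x"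
    using conv by eventually_elim (auto simp: f_def convergent_LIMSEQ_iff)
  have lim_int: "(\<lambda>k. \<integral>x. g k x \<partial>M) \<longlonglongrightarrow> (\<integral>x. f x \<partial>M)"
  proof (rule integral_dominated_convergence[where w="\<lambda>_. 1"])
    show "AE x in M. norm (g k x) \<le> 1" for k
      using g norm_prob_simplex_le by (intro AE_I2) (auto simp: selections_def)
  qed (use gm f_meas lim in auto)
  have lim_C: "(\<lambda>k. \<integral>x. C x \<bullet> g k x \<partial>M) \<longlonglongrightarrow> (\<integral>x. C x \<bullet> f x \<partial>M)"
  proof (rule integral_dominated_convergence[where w="\<lambda>_. B"])
    show "AE x in M. (\<lambda>k. C x \<bullet> g k x) \<longlonglongrightarrow> C x \<bullet> f x"
      using lim by eventually_elim (intro tendsto_intros)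
    show "AE x in M. norm (C x \<bullet> g k x) \<le> B" for k
      using norm_inner_selection_le[OF g] C(2) by (intro AE_I2) blast
  qed (use C(1) gm f_meas in auto)
  have "\<exists>lam t. F lam \<le> ereal t \<and> norm (lam - (\<integral>x. g k x \<partial>M)) \<le> 1 / real (Suc k)
          \<and> (\<integral>x. C x \<bullet> g k x \<partial>M) + t \<le> T k" for k
    using gS[of k] by (auto simp: S_def E_def perturbed_values_def)
  then obtain lam t where F_le: "\<And>k. F (lam k) \<le> ereal (t k)"
    and near: "\<And>k. norm (lam k - (\<integral>x. g k x \<partial>M)) \<le> 1 / real (Suc k)"
    and le_T: "\<And>k. (\<integral>x. C x \<bullet> g k x \<partial>M) + t k \<le> T k"
    by metis
  have "(\<lambda>k. lam k - (\<integral>x. g k x \<partial>M)) \<longlonglongrightarrow> 0"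
    using near by (intro Lim_null_comparison[OF _ LIMSEQ_Suc[OF lim_1_over_n]] always_eventually) auto
  from tendsto_add[OF this lim_int] have lam: "lam \<longlonglongrightarrow> (\<integral>x. f x \<partial>M)" by simp
  have "F (\<integral>x. f x \<partial>M) \<le> ereal (T m - (\<integral>x. C x \<bullet> f x \<partial>M))" for m
  proof (rule dense_le)
    fix a assume "a < F (\<integral>x. f x \<partial>M)"
    then have "eventually (\<lambda>z. a < F z) (nhds (\<integral>x. f x \<partial>M))"
      by (rule closed_fun_eventually_gt[OF F(1)])
    then have "eventually (\<lambda>k. a < F (lam k)) sequentially"
      using lam by (rule eventually_compose_filterlim)
    then have "eventually (\<lambda>k. a \<le> ereal (T m - (\<integral>x. C x \<bullet> g k x \<partial>M))) sequentially"
      using eventually_ge_at_top[of m]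
    proof eventually_elim
      case (elim k)
      have "t k \<le> T m - (\<integral>x. C x \<bullet> g k x \<partial>M)"
        using le_T[of k] decseqD[OF T elim(2)] by simp
      then show ?case using elim(1) F_le[of k] by (meson ereal_less_eq(3) less_imp_le order_trans)
    qed
    moreover have "(\<lambda>k. ereal (T m - (\<integral>x. C x \<bullet> g k x \<partial>M))) \<longlonglongrightarrow> ereal (T m - (\<integral>x. C x \<bullet> f x \<partial>M))"
      using lim_C by (intro tendsto_intros)
    ultimately show "a \<le> ereal (T m - (\<integral>x. C x \<bullet> f x \<partial>M))"
      by (intro tendsto_lowerbound) auto
  qed
  then have "ereal (\<integral>x. C x \<bullet> f x \<partial>M) + F (\<integral>x. f x \<partial>M) \<le> ereal (T m)" for m
    using add_left_mono[of "F (\<integral>x. f x \<partial>M)" "ereal (T m - (\<integral>x. C x \<bullet> f x \<partial>M))" "ereal (\<integral>x. C x \<bullet> f x \<partial>M)"]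
    by simp
  with f that show ?thesis by blast
qed

text \<open>Strict separation of \<open>(0, T)\<close> from the convex set of perturbed values gives a normal \<open>(\<xi>, s)\<close>. A
constant selection with value in the domain of \<open>F\<close> satisfies the constraint exactly and its objective
can be raised above \<open>T\<close>, which forces \<open>s > 0\<close>. Then \<open>\<psi> = - \<xi> / s\<close> is the multiplier: the
separation inequality for a selection that minimises \<open>C + \<psi>\<close> pointwise bounds the Legendre
transform.\<close>

lemma (in prob_space) separation_multiplier:
  fixes C :: "'a \<Rightarrow> real ^ 'm"
  assumes C: "C \<in> borel_measurable M" "\<And>x. x \<in> space M \<Longrightarrow> norm (C x) \<le> B"
    and F: "convex_fun F" "\<And>lam. F lam \<noteq> - \<infinity>" "proper_fun F" "eff_dom F \<subseteq> prob_simplex"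
    and far: "\<And>f z r. f \<in> selections M \<Longrightarrow> (z, r) \<in> perturbed_values M C F f \<Longrightarrow>
        norm z \<le> e \<Longrightarrow> r \<le> T + e \<Longrightarrow> False"
    and e: "0 < e"
  obtains \<psi> where "ereal T \<le> ereal (\<integral>x. (MIN j. C x $ j + \<psi> $ j) \<partial>M) - legendre F \<psi>"
proof -
  define D where "D = (\<Union>f\<in>selections M. perturbed_values M C F f)"
  have "convex D"
  proof (rule convexI)
    fix p q :: "(real ^ 'm) \<times> real" and u v :: real
    assume "p \<in> D" "q \<in> D" and uv: "0 \<le> u" "0 \<le> v" "u + v = 1"
    then obtain f g where f: "f \<in> selections M" "p \<in> perturbed_values M C F f"
      and g: "g \<in> selections M" "q \<in> perturbed_values M C F g"
      by (auto simp: D_def)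
    show "u *\<^sub>R p + v *\<^sub>R q \<in> D"
      using perturbed_values_convex_combination[OF C F(1) f g uv]
        convex_combination_selection[OF f(1) g(1) uv]
      unfolding D_def by blast
  qed
  moreover have "(0, T) \<notin> closure D"
  proof
    assume "(0, T) \<in> closure D"
    then obtain z r where zr: "(z, r) \<in> D" "dist (z, r) (0, T) < e"
      using e unfolding closure_approachable by fast
    have "norm z \<le> e" "r \<le> T + e"
      using dist_fst_le[of "(z, r)" "(0, T)"] dist_snd_le[of "(z, r)" "(0, T)"] zr(2)
      by (auto simp: dist_norm)
    then show False using far zr(1) unfolding D_def by blast
  qed
  ultimately obtain \<xi> s b where b: "s * T < b" and sep: "\<And>z r. (z, r) \<in> D \<Longrightarrow> b < \<xi> \<bullet> z + s * r"
    using separating_hyperplane_closed_point[of "closure D" "(0, T)"]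
    by (force simp: convex_closure inner_Pair dest: subsetD[OF closure_subset])
  have sep': "b < \<xi> \<bullet> (lam - (\<integral>x. f x \<partial>M)) + s * ((\<integral>x. C x \<bullet> f x \<partial>M) + t)"
    if "f \<in> selections M" "F lam \<le> ereal t" for f lam t
    using that by (intro sep) (auto simp: D_def perturbed_values_def)
  have "0 < s"
  proof (rule ccontr)
    assume "\<not> 0 < s"
    obtain lam where "F lam \<noteq> \<infinity>" using F(3) by (auto simp: proper_fun_def)
    then obtain t where t: "F lam = ereal t" using F(2)[of lam] by (cases "F lam") auto
    have "lam \<in> prob_simplex" using \<open>F lam \<noteq> \<infinity>\<close> F(4) by (auto simp: eff_dom_def)
    then have const: "(\<lambda>x. lam) \<in> selections M" by (rule const_selection)
    define A where "A = (\<integral>x. C x \<bullet> lam \<partial>M)"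
    have "b < s * (A + max t (T - A))"
      using sep'[OF const, of lam "max t (T - A)"] t by (simp add: A_def prob_space)
    also have "\<dots> \<le> s * T" using \<open>\<not> 0 < s\<close> by (intro mult_left_mono_neg) auto
    finally show False using b by simp
  qed
  define \<psi> where "\<psi> = - (1 / s) *\<^sub>R \<xi>"
  have C\<psi>: "(\<lambda>x. C x + \<psi>) \<in> borel_measurable M" using C(1) by measurable
  obtain f where f: "f \<in> selections M" and f_min: "\<And>x. (C x + \<psi>) \<bullet> f x = (MIN j. (C x + \<psi>) $ j)"
    using argmin_selection[OF C\<psi>] by blast
  define m where "m = (\<integral>x. (MIN j. C x $ j + \<psi> $ j) \<partial>M)"
  have m: "m = (\<integral>x. C x \<bullet> f x \<partial>M) + \<psi> \<bullet> (\<integral>x. f x \<partial>M)"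
  proof -
    have "m = (\<integral>x. C x \<bullet> f x + \<psi> \<bullet> f x \<partial>M)"
      unfolding m_def using f_min by (simp add: inner_add_left)
    then show ?thesis
      using integrable_selection[OF f] integrable_inner_selection[OF f C] by simp
  qed
  have "legendre F \<psi> \<le> ereal (m - T)"
    unfolding legendre_def
  proof (rule SUP_least)
    fix lam
    show "ereal (\<psi> \<bullet> lam) - F lam \<le> ereal (m - T)"
    proof (cases "F lam")
      case (real t)
      have "\<xi> = - s *\<^sub>R \<psi>" using \<open>0 < s\<close> by (simp add: \<psi>_def)
      then have "s * T < s * (m - \<psi> \<bullet> lam + t)"
        using sep'[OF f, of lam t] b real m by (simp add: inner_diff_right algebra_simps)
      then show ?thesis using real \<open>0 < s\<close> by simp
    qed (use F(2) in auto)
  qed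
  then have "ereal m - ereal (m - T) \<le> ereal m - legendre F \<psi>"
    by (intro ereal_minus_mono) auto
  then show ?thesis using that[of \<psi>] unfolding m_def by simp
qed

section \<open>Weak duality\<close>

lemma borel_prob_onD:
  assumes "borel_prob_on S M"
  shows "prob_space M" "sets M = sets (restrict_space borel S)" "space M = S"
  using assms sets_eq_imp_space_eq[of M "restrict_space borel S"]
  by (auto simp: borel_prob_on_def space_restrict_space)

lemma continuous_on_borel_prob_on:
  assumes "borel_prob_on S M" "continuous_on S f"
  shows "f \<in> borel_measurable M"
  using borel_measurable_continuous_on_restrict[OF assms(2)] borel_prob_onD(2)[OF assms(1)]
  by (simp cong: measurable_cong_sets)

lemma continuous_integrable_borel_prob_on:
  fixes f :: "'a::topological_space \<Rightarrow> real"
  assumes M: "borel_prob_on S M" and "compact S" and f: "continuous_on S f"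
  shows "integrable M f"
proof -
  interpret prob_space M by (rule borel_prob_onD(1)[OF M])
  obtain B where "\<And>x. x \<in> S \<Longrightarrow> norm (f x) \<le> B"
    using compact_imp_bounded[OF compact_continuous_image[OF f \<open>compact S\<close>]]
    by (auto simp: bounded_iff)
  then show ?thesis
    using continuous_on_borel_prob_on[OF M f] borel_prob_onD(3)[OF M]
    by (intro integrable_const_bound[where B=B]) auto
qed

lemma measurable_projections:
  assumes \<mu>: "sets \<mu> = sets (restrict_space borel X)" and \<nu>: "sets \<nu> = sets (restrict_space borel Y)"
    and \<gamma>: "sets \<gamma> = sets (restrict_space borel (X \<times> Y))"
  shows "fst \<in> measurable \<gamma> \<mu>" and "snd \<in> measurable \<gamma> \<nu>"
  using borel_measurable_continuous_on_restrict[of "X \<times> Y" fst]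
    borel_measurable_continuous_on_restrict[of "X \<times> Y" snd]
  by (auto simp: measurable_cong_sets[OF \<gamma> \<mu>] measurable_cong_sets[OF \<gamma> \<nu>] space_restrict_space
      measurable_restrict_space2_iff continuous_on_fst continuous_on_snd)

lemma measure_nu_singleton:
  fixes y :: "'m::finite \<Rightarrow> 'a::t1_space"
  assumes "inj y" and "lam \<in> prob_simplex"
  shows "{y j} \<in> sets (nu y lam)" and "measure (nu y lam) {y j} = lam $ j"
proof -
  show s: "{y j} \<in> sets (nu y lam)"
    unfolding sets_nu by (auto simp: sets_restrict_space intro!: image_eqI[of _ _ "{y j}"])
  have "emeasure (nu y lam) {y j} = (\<Sum>i\<in>UNIV. ennreal (lam $ i) * indicator {y j} (y i))"
    using s by (simp add: sets_nu emeasure_nu)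
  also have "\<dots> = (\<Sum>i\<in>UNIV. if i = j then ennreal (lam $ i) else 0)"
    using \<open>inj y\<close> by (intro sum.cong) (auto simp: inj_eq)
  finally have "emeasure (nu y lam) {y j} = ennreal (lam $ j)" by simp
  then show "measure (nu y lam) {y j} = lam $ j"
    using assms(2) by (simp add: measure_def prob_simplex_def)
qed

text \<open>Integrating the constraint \<open>- \<phi> x - \<psi>\<^sub>j \<le> c (x, y j)\<close> against the coupling involves only its
marginals, and \<open>\<psi> \<bullet> lam - F lam\<close> is one of the terms of the supremum that defines the Legendre
transform.\<close>

lemma weak_duality:
  fixes X :: "'a::metric_space set" and y :: "'m::finite \<Rightarrow> 'b::metric_space"
  assumes y: "inj y" and X: "compact X" and \<mu>: "borel_prob_on X \<mu>"
    and F: "\<And>lam. F lam \<noteq> - \<infinity>"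
    and c: "continuous_on (X \<times> range y) c"
    and p: "p \<in> primal_feasible \<mu> y" and q: "q \<in> dual_feasible X y c"
  shows "dual_value \<mu> F q \<le> primal_cost c F p"
proof -
  obtain lam \<gamma> where p_eq: "p = (lam, \<gamma>)" and lam: "lam \<in> prob_simplex"
    and \<gamma>: "borel_prob_on (X \<times> range y) \<gamma>"
    and fst: "distr \<gamma> \<mu> fst = \<mu>" and snd: "distr \<gamma> (nu y lam) snd = nu y lam"
    using p borel_prob_onD(3)[OF \<mu>]
    by (auto simp: primal_feasible_def couplings_def space_nu)
  obtain \<phi> \<psi> where q_eq: "q = (\<phi>, \<psi>)" and \<phi>: "continuous_on X \<phi>"
    and le_c: "\<And>x j. x \<in> X \<Longrightarrow> - \<phi> x - \<psi> $ j \<le> c (x, y j)"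
    using q by (auto simp: dual_feasible_def)
  have sets_\<gamma>: "sets \<gamma> = sets (restrict_space borel (X \<times> range y))"
    and space_\<gamma>: "space \<gamma> = X \<times> range y"
    using borel_prob_onD[OF \<gamma>] by auto
  have K: "compact (X \<times> range y)" using X by (simp add: compact_Times finite_imp_compact)
  note fst_meas = measurable_projections(1)[OF borel_prob_onD(2)[OF \<mu>] sets_nu sets_\<gamma>]
  note snd_meas = measurable_projections(2)[OF borel_prob_onD(2)[OF \<mu>] sets_nu[of y lam] sets_\<gamma>]
  \<comment> \<open>The vector \<open>\<psi>\<close> as a function on the points of \<open>range y\<close>.\<close>
  define h where "h z = (\<Sum>j\<in>UNIV. \<psi> $ j * indicator {y j} z)" for z
  have h_y: "h (y j) = \<psi> $ j" for j
  proof -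
    have "h (y j) = (\<Sum>i\<in>UNIV. if i = j then \<psi> $ i else 0)"
      unfolding h_def using y by (intro sum.cong) (auto simp: inj_eq)
    then show ?thesis by simp
  qed
  have h_meas: "h \<in> borel_measurable (nu y lam)"
    unfolding h_def using measure_nu_singleton(1)[OF y lam] by measurable
  interpret \<gamma>: prob_space \<gamma> by (rule borel_prob_onD(1)[OF \<gamma>])
  interpret \<nu>: prob_space "nu y lam"
    using \<gamma>.prob_space_distr[OF snd_meas] by (simp add: snd)
  have int_\<phi>: "(\<integral>z. \<phi> (fst z) \<partial>\<gamma>) = (\<integral>x. \<phi> x \<partial>\<mu>)"
    using integral_distr[OF fst_meas continuous_on_borel_prob_on[OF \<mu> \<phi>]] by (simp add: fst)
  have "(\<integral>z. h (snd z) \<partial>\<gamma>) = (\<integral>z. h z \<partial>nu y lam)"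
    using integral_distr[OF snd_meas h_meas] by (simp add: snd)
  also have "\<dots> = \<psi> \<bullet> lam"
    unfolding h_def inner_vec_def using measure_nu_singleton[OF y lam]
    by (subst Bochner_Integration.integral_sum) (auto simp: \<nu>.emeasure_eq_measure)
  finally have int_h: "(\<integral>z. h (snd z) \<partial>\<gamma>) = \<psi> \<bullet> lam" .
  have integrable_\<phi>: "integrable \<gamma> (\<lambda>z. \<phi> (fst z))"
    using continuous_on_compose2[OF \<phi> continuous_on_fst[OF continuous_on_id], of "X \<times> range y"]
    by (intro continuous_integrable_borel_prob_on[OF \<gamma> K]) auto
  have "integrable (nu y lam) h"
    unfolding h_def using measure_nu_singleton(1)[OF y lam]
    by (intro Bochner_Integration.integrable_sum) (auto simp: \<nu>.emeasure_eq_measure)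
  then have integrable_h: "integrable \<gamma> (\<lambda>z. h (snd z))"
    by (intro integrable_distr[OF snd_meas]) (simp add: snd)
  have integrable_c: "integrable \<gamma> c"
    by (rule continuous_integrable_borel_prob_on[OF \<gamma> K c])
  have "(\<integral>z. - \<phi> (fst z) - h (snd z) \<partial>\<gamma>) \<le> (\<integral>z. c z \<partial>\<gamma>)"
    using integrable_\<phi> integrable_h integrable_c le_c
    by (intro integral_mono) (auto simp: space_\<gamma> h_y)
  then have le: "- (\<integral>x. \<phi> x \<partial>\<mu>) - \<psi> \<bullet> lam \<le> (\<integral>z. c z \<partial>\<gamma>)"
    using integrable_\<phi> integrable_h by (simp add: int_\<phi> int_h)
  show ?thesis
  proof (cases "F lam")
    case (real t)
    have "ereal (\<psi> \<bullet> lam - t) \<le> legendre F \<psi>"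
      using real unfolding legendre_def by (intro SUP_upper2[of lam]) auto
    then have "dual_value \<mu> F q \<le> ereal (- (\<integral>x. \<phi> x \<partial>\<mu>)) - ereal (\<psi> \<bullet> lam - t)"
      unfolding dual_value_def q_eq prod.case by (intro ereal_minus_mono order_refl)
    also have "\<dots> \<le> primal_cost c F p" using le real by (simp add: primal_cost_def p_eq)
    finally show ?thesis .
  next
    case PInf
    then show ?thesis by (simp add: primal_cost_def p_eq)
  next
    case MInf
    then show ?thesis using F by simp
  qed
qed

section \<open>The coupling of a selection\<close>

definition coupling_of_selection ::
  "'a measure \<Rightarrow> ('m::finite \<Rightarrow> 'b) \<Rightarrow> ('a \<Rightarrow> real ^ 'm) \<Rightarrow> ('a::topological_space \<times> 'b::topological_space) measure"
  where "coupling_of_selection \<mu> y f =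
    distr (density (\<mu> \<Otimes>\<^sub>M count_space UNIV) (\<lambda>(x, j). ennreal (f x $ j)))
      (restrict_space borel (space \<mu> \<times> range y)) (\<lambda>(x, j). (x, y j))"

lemma
  assumes "borel_prob_on X \<mu>"
  shows sets_coupling_of_selection:
      "sets (coupling_of_selection \<mu> y f) = sets (restrict_space borel (X \<times> range y))"
    and space_coupling_of_selection: "space (coupling_of_selection \<mu> y f) = X \<times> range y"
  by (simp_all add: coupling_of_selection_def borel_prob_onD(3)[OF assms] space_restrict_space)

text \<open>This is the change of variables along \<open>(x, j) \<mapsto> (x, y j)\<close>, followed by Tonelli with a counting
measure. Applied to indicators it gives both marginals, and applied to \<open>c\<close> it gives the cost.\<close>

lemma nn_integral_coupling_of_selection:
  fixes X :: "'a::second_countable_topology set" and y :: "'m::finite \<Rightarrow> 'b::second_countable_topology"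
    and f :: "'a \<Rightarrow> real ^ 'm"
  assumes \<mu>: "borel_prob_on X \<mu>" and f: "f \<in> borel_measurable \<mu>"
    and h: "h \<in> borel_measurable (restrict_space borel (X \<times> range y))"
  shows "(\<integral>\<^sup>+z. h z \<partial>coupling_of_selection \<mu> y f)
       = (\<integral>\<^sup>+x. (\<Sum>j\<in>UNIV. ennreal (f x $ j) * h (x, y j)) \<partial>\<mu>)"
proof -
  note \<mu>D = borel_prob_onD[OF \<mu>]
  have id_meas: "(\<lambda>x. x) \<in> borel_measurable \<mu>"
    by (rule continuous_on_borel_prob_on[OF \<mu> continuous_on_id])
  have g: "(\<lambda>(x, j). (x, y j)) \<in> measurable (\<mu> \<Otimes>\<^sub>M count_space UNIV) (restrict_space borel (X \<times> range y))"
  proof (rule measurable_restrict_space2)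
    show "(\<lambda>(x, j). (x, y j)) \<in> borel_measurable (\<mu> \<Otimes>\<^sub>M count_space UNIV)"
      unfolding borel_prod[symmetric] using id_meas by measurable
  qed (auto simp: space_pair_measure \<mu>D(3))
  have f_nth: "(\<lambda>x. f x $ j) \<in> borel_measurable \<mu>" for j
    using f by (rule borel_measurable_vec_nth)
  have d: "(\<lambda>(x, j). ennreal (f x $ j)) \<in> borel_measurable (\<mu> \<Otimes>\<^sub>M count_space UNIV)"
  proof -
    have "(\<lambda>w. ennreal (f (fst w) $ j)) \<in> borel_measurable (\<mu> \<Otimes>\<^sub>M count_space (UNIV :: 'm set))" for j
      using f_nth[of j] by measurable
    from measurable_compose_countable[OF this measurable_snd] show ?thesis
      by (simp add: case_prod_beta')
  qed
  have hg: "(\<lambda>(x, j). h (x, y j)) \<in> borel_measurable (\<mu> \<Otimes>\<^sub>M count_space UNIV)"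
    using measurable_compose[OF g h] by (simp add: case_prod_beta')
  interpret cs: sigma_finite_measure "count_space (UNIV :: 'm set)"
    by (rule sigma_finite_measure_count_space_finite) simp
  have "(\<integral>\<^sup>+z. h z \<partial>coupling_of_selection \<mu> y f)
      = (\<integral>\<^sup>+w. (case w of (x, j) \<Rightarrow> ennreal (f x $ j)) * h (case w of (x, j) \<Rightarrow> (x, y j))
           \<partial>(\<mu> \<Otimes>\<^sub>M count_space UNIV))"
    unfolding coupling_of_selection_def \<mu>D(3)
    using g h d hg by (simp add: nn_integral_distr nn_integral_density case_prod_beta')
  also have "\<dots> = (\<integral>\<^sup>+x. (\<integral>\<^sup>+j. ennreal (f x $ j) * h (x, y j) \<partial>count_space UNIV) \<partial>\<mu>)"
    using d hg by (subst cs.nn_integral_fst[symmetric]) (auto simp: case_prod_beta')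
  also have "\<dots> = (\<integral>\<^sup>+x. (\<Sum>j\<in>UNIV. ennreal (f x $ j) * h (x, y j)) \<partial>\<mu>)"
    by (simp add: nn_integral_count_space_finite)
  finally show ?thesis .
qed

lemma coupling_of_selection_in_couplings:
  fixes X :: "'a::second_countable_topology set" and y :: "'m::finite \<Rightarrow> 'b::second_countable_topology"
  assumes \<mu>: "borel_prob_on X \<mu>" and f: "f \<in> selections \<mu>"
  shows "coupling_of_selection \<mu> y f \<in> couplings \<mu> (nu y (\<integral>x. f x \<partial>\<mu>))"
proof -
  let ?\<gamma> = "coupling_of_selection \<mu> y f" and ?\<nu> = "nu y (\<integral>x. f x \<partial>\<mu>)"
  note \<mu>D = borel_prob_onD[OF \<mu>]
  interpret \<mu>: prob_space \<mu> by (rule \<mu>D(1))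
  have f_meas: "f \<in> borel_measurable \<mu>" using f by (simp add: selections_def)
  have f_nth: "(\<lambda>x. f x $ j) \<in> borel_measurable \<mu>" for j
    using f_meas by (rule borel_measurable_vec_nth)
  have f_nonneg: "0 \<le> f x $ j" and f_sum: "(\<Sum>j\<in>UNIV. f x $ j) = 1" if "x \<in> X" for x j
    using f that by (auto simp: selections_def prob_simplex_def \<mu>D(3))
  note sets_\<gamma> = sets_coupling_of_selection[OF \<mu>, of y f]
    and space_\<gamma> = space_coupling_of_selection[OF \<mu>, of y f]
  note nn = nn_integral_coupling_of_selection[OF \<mu> f_meas, of _ y]
  have sum1: "(\<Sum>j\<in>UNIV. ennreal (f x $ j)) = 1" if "x \<in> X" for x
    using f_nonneg[OF that] f_sum[OF that] by (simp add: sum_ennreal)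
  note fst_meas = measurable_projections(1)[OF \<mu>D(2) sets_nu sets_\<gamma>]
  note snd_meas = measurable_projections(2)[OF \<mu>D(2) sets_nu[of y "\<integral>x. f x \<partial>\<mu>"] sets_\<gamma>]
  have em: "emeasure ?\<gamma> A = (\<integral>\<^sup>+x. (\<Sum>j\<in>UNIV. ennreal (f x $ j) * indicator A (x, y j)) \<partial>\<mu>)"
    if "A \<in> sets ?\<gamma>" for A
    using that nn[of "indicator A"] sets_\<gamma> by simp
  have distr_fst: "distr ?\<gamma> \<mu> fst = \<mu>"
  proof (rule measure_eqI)
    fix A assume "A \<in> sets (distr ?\<gamma> \<mu> fst)"
    then have A: "A \<in> sets \<mu>" by simp
    have "emeasure (distr ?\<gamma> \<mu> fst) A
        = (\<integral>\<^sup>+x. (\<Sum>j\<in>UNIV. ennreal (f x $ j) * indicator (fst -` A \<inter> space ?\<gamma>) (x, y j)) \<partial>\<mu>)"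
      using A fst_meas by (simp add: emeasure_distr em measurable_sets)
    also have "\<dots> = (\<integral>\<^sup>+x. (\<Sum>j\<in>UNIV. ennreal (f x $ j)) * indicator A x \<partial>\<mu>)"
      by (intro nn_integral_cong) (auto simp: sum_distrib_right space_\<gamma> \<mu>D(3) split: split_indicator)
    also have "\<dots> = (\<integral>\<^sup>+x. indicator A x \<partial>\<mu>)"
      by (intro nn_integral_cong) (simp add: sum1 \<mu>D(3))
    also have "\<dots> = emeasure \<mu> A" using A by simp
    finally show "emeasure (distr ?\<gamma> \<mu> fst) A = emeasure \<mu> A" .
  qed simp
  have mass: "(\<integral>\<^sup>+x. ennreal (f x $ j) \<partial>\<mu>) = ennreal ((\<integral>x. f x \<partial>\<mu>) $ j)" for j
  proof -
    have "(\<integral>\<^sup>+x. ennreal (f x $ j) \<partial>\<mu>) = ennreal (\<integral>x. f x $ j \<partial>\<mu>)"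
      using f_nonneg
      by (intro nn_integral_eq_integral \<mu>.integrable_selection_nth[OF f] AE_I2) (auto simp: \<mu>D(3))
    then show ?thesis by (simp add: \<mu>.integral_selection_nth[OF f])
  qed
  have distr_snd: "distr ?\<gamma> ?\<nu> snd = ?\<nu>"
  proof (rule measure_eqI)
    fix A assume "A \<in> sets (distr ?\<gamma> ?\<nu> snd)"
    then have A: "A \<in> sets ?\<nu>" by simp
    have "emeasure (distr ?\<gamma> ?\<nu> snd) A
        = (\<integral>\<^sup>+x. (\<Sum>j\<in>UNIV. ennreal (f x $ j) * indicator (snd -` A \<inter> space ?\<gamma>) (x, y j)) \<partial>\<mu>)"
      using A snd_meas by (simp add: emeasure_distr em measurable_sets)
    also have "\<dots> = (\<integral>\<^sup>+x. (\<Sum>j\<in>UNIV. ennreal (f x $ j) * indicator A (y j)) \<partial>\<mu>)"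
      by (intro nn_integral_cong sum.cong) (auto simp: space_\<gamma> \<mu>D(3) split: split_indicator)
    also have "\<dots> = (\<Sum>j\<in>UNIV. ennreal ((\<integral>x. f x \<partial>\<mu>) $ j) * indicator A (y j))"
      using f_nth by (simp add: nn_integral_sum nn_integral_multc mass)
    also have "\<dots> = emeasure ?\<nu> A" using A by (simp add: emeasure_nu sets_nu)
    finally show "emeasure (distr ?\<gamma> ?\<nu> snd) A = emeasure ?\<nu> A" .
  qed simp
  have "prob_space ?\<gamma>"
    using prob_space_distrD[OF fst_meas] \<mu>D(1) by (simp add: distr_fst)
  then show ?thesis
    using distr_fst distr_snd sets_\<gamma> by (simp add: couplings_def borel_prob_on_def space_nu \<mu>D(3))
qed

lemma integral_coupling_of_selection:
  fixes X :: "'a::second_countable_topology set" and y :: "'m::finite \<Rightarrow> 'b::second_countable_topology"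
    and c :: "'a \<times> 'b \<Rightarrow> real"
  assumes \<mu>: "borel_prob_on X \<mu>" and f: "f \<in> selections \<mu>"
    and c: "c \<in> borel_measurable (restrict_space borel (X \<times> range y))"
    and c_nonneg: "\<And>z. z \<in> X \<times> range y \<Longrightarrow> 0 \<le> c z"
    and C: "(\<lambda>x. \<chi> j. c (x, y j)) \<in> borel_measurable \<mu>"
  shows "(\<integral>z. c z \<partial>coupling_of_selection \<mu> y f) = (\<integral>x. (\<chi> j. c (x, y j)) \<bullet> f x \<partial>\<mu>)"
proof -
  let ?\<gamma> = "coupling_of_selection \<mu> y f"
  note \<mu>D = borel_prob_onD[OF \<mu>]
  have f_meas: "f \<in> borel_measurable \<mu>" using f by (simp add: selections_def)
  have f_nonneg: "0 \<le> f x $ j" if "x \<in> X" for x j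
    using f that by (auto simp: selections_def prob_simplex_def \<mu>D(3))
  note sets_\<gamma> = sets_coupling_of_selection[OF \<mu>, of y f]
    and space_\<gamma> = space_coupling_of_selection[OF \<mu>, of y f]
  have "(\<integral>z. c z \<partial>?\<gamma>) = enn2real (\<integral>\<^sup>+z. ennreal (c z) \<partial>?\<gamma>)"
    using c c_nonneg sets_\<gamma>
    by (intro integral_eq_nn_integral) (auto simp: space_\<gamma> cong: measurable_cong_sets)
  also have "(\<integral>\<^sup>+z. ennreal (c z) \<partial>?\<gamma>)
      = (\<integral>\<^sup>+x. (\<Sum>j\<in>UNIV. ennreal (f x $ j) * ennreal (c (x, y j))) \<partial>\<mu>)"
    using c by (intro nn_integral_coupling_of_selection[OF \<mu> f_meas]) auto
  also have "\<dots> = (\<integral>\<^sup>+x. ennreal ((\<chi> j. c (x, y j)) \<bullet> f x) \<partial>\<mu>)"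
    using f_nonneg c_nonneg
    by (intro nn_integral_cong)
       (simp add: inner_vec_def \<mu>D(3) ennreal_mult'[symmetric] sum_ennreal mult.commute)
  also have "enn2real \<dots> = (\<integral>x. (\<chi> j. c (x, y j)) \<bullet> f x \<partial>\<mu>)"
  proof (rule integral_eq_nn_integral[symmetric])
    show "AE x in \<mu>. 0 \<le> (\<chi> j. c (x, y j)) \<bullet> f x"
      using f_nonneg c_nonneg by (intro AE_I2) (auto simp: inner_vec_def \<mu>D(3) intro!: sum_nonneg)
  qed (use C f_meas in measurable)
  finally show ?thesis .
qed

section \<open>Strong duality and attainment\<close>

lemma continuous_on_Min_finite:
  fixes f :: "'i \<Rightarrow> 'a::topological_space \<Rightarrow> 'b::linorder_topology"
  assumes "finite I" "I \<noteq> {}" "\<And>i. i \<in> I \<Longrightarrow> continuous_on S (f i)"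
  shows "continuous_on S (\<lambda>x. MIN i\<in>I. f i x)"
  using assms
proof (induction I rule: finite_ne_induct)
  case (insert i I)
  then have "continuous_on S (\<lambda>x. min (f i x) (MIN i\<in>I. f i x))"
    by (intro continuous_on_min) auto
  then show ?case using insert.hyps by simp
qed simp

text \<open>For fixed \<open>\<psi>\<close> the integrand on the left is \<open>- \<phi>\<close> for the smallest admissible \<open>\<phi>\<close>, which is
continuous as a finite minimum.\<close>

lemma reduced_dual_value_le_SUP:
  fixes y :: "'m::finite \<Rightarrow> 'b::topological_space" and c :: "'a::topological_space \<times> 'b \<Rightarrow> real"
  assumes "\<And>j. continuous_on X (\<lambda>x. c (x, y j))"
  shows "ereal (\<integral>x. (MIN j. c (x, y j) + \<psi> $ j) \<partial>\<mu>) - legendre F \<psi>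
    \<le> (SUP q\<in>dual_feasible X y c. dual_value \<mu> F q)"
proof (rule SUP_upper2)
  let ?\<phi> = "\<lambda>x. - (MIN j. c (x, y j) + \<psi> $ j)"
  have cont: "continuous_on X ?\<phi>"
    using assms by (intro continuous_on_minus continuous_on_Min_finite continuous_on_add continuous_on_const) auto
  have "(MIN i. c (x, y i) + \<psi> $ i) \<le> c (x, y j) + \<psi> $ j" for x j
    by (rule Min_le) auto
  then have "- ?\<phi> x - \<psi> $ j \<le> c (x, y j)" for x j
    unfolding minus_minus diff_le_eq .
  with cont show "(?\<phi>, \<psi>) \<in> dual_feasible X y c"
    by (simp only: dual_feasible_def mem_Collect_eq prod.case) blast
qed (simp only: dual_value_def prod.case Bochner_Integration.integral_minus minus_minus order_refl)

lemma ereal_approx_from_above: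
  fixes d :: ereal
  assumes "d \<noteq> \<infinity>"
  obtains T :: "nat \<Rightarrow> real" where "decseq T" "\<And>k. d < ereal (T k)"
    "\<And>x. (\<And>k. x \<le> ereal (T k)) \<Longrightarrow> x \<le> d"
proof (cases d)
  case (real r)
  show ?thesis
  proof (rule that[of "\<lambda>k. r + 1 / real (Suc k)"])
    show "decseq (\<lambda>k. r + 1 / real (Suc k))" by (auto simp: decseq_def frac_le)
    have "(\<lambda>k. ereal (r + 1 / real (Suc k))) \<longlonglongrightarrow> ereal (r + 0)"
      by (intro tendsto_ereal tendsto_add tendsto_const LIMSEQ_Suc[OF lim_1_over_n])
    then show "x \<le> d" if "\<And>k. x \<le> ereal (r + 1 / real (Suc k))" for x
      using that real by (auto intro: LIMSEQ_le_const)
  qed (simp add: real)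
next
  case MInf
  show ?thesis
  proof (rule that[of "\<lambda>k. - real k"])
    show "x \<le> d" if le: "\<And>k. x \<le> ereal (- real k)" for x
    proof (cases x)
      case (real s)
      obtain k :: nat where "- s < real k" using reals_Archimedean2 by blast
      then show ?thesis using le[of k] real by simp
    qed (use le[of 0] MInf in auto)
  qed (auto simp: MInf decseq_def)
qed (use assms in simp)

theorem theorem3p3:
  fixes X :: "(real ^ 'n) set"
    and \<mu> :: "(real ^ 'n) measure"
    and y :: "'m::finite \<Rightarrow> real ^ 'n"
    and F :: "real ^ 'm \<Rightarrow> ereal"
    and c :: "(real ^ 'n) \<times> (real ^ 'n) \<Rightarrow> real"
  assumes "inj y"
    and "compact X"
    and "borel_prob_on X \<mu>"
    and "spt \<mu> = X"
    and "\<And>lam. F lam \<noteq> - \<infinity>"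
    and "proper_fun F"
    and "closed_fun F"
    and "convex_fun F"
    and "eff_dom F \<subseteq> prob_simplex"
    and "continuous_on (X \<times> range y) c"
    and "\<And>z. z \<in> X \<times> range y \<Longrightarrow> 0 \<le> c z"
  shows "\<exists>p. is_arg_min (primal_cost c F) (\<lambda>p. p \<in> primal_feasible \<mu> y) p
           \<and> primal_cost c F p = (SUP q\<in>dual_feasible X y c. dual_value \<mu> F q)"
proof -
  note \<mu> = \<open>borel_prob_on X \<mu>\<close>
  interpret prob_space \<mu> by (rule borel_prob_onD(1)[OF \<mu>])
  define d where "d = (SUP q\<in>dual_feasible X y c. dual_value \<mu> F q)"
  define C where "C x = (\<chi> j. c (x, y j))" for x
  have c_nth: "continuous_on X (\<lambda>x. c (x, y j))" for j
    by (intro continuous_on_compose2[OF \<open>continuous_on (X \<times> range y) c\<close>] continuous_intros) auto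
  then have C_cont: "continuous_on X C"
    unfolding C_def by (intro continuous_on_vec_lambda)
  then have C_meas: "C \<in> borel_measurable \<mu>"
    by (rule continuous_on_borel_prob_on[OF \<mu>])
  obtain B where C_le: "\<And>x. x \<in> space \<mu> \<Longrightarrow> norm (C x) \<le> B"
    using compact_imp_bounded[OF compact_continuous_image[OF C_cont \<open>compact X\<close>]]
    by (auto simp: bounded_iff borel_prob_onD(3)[OF \<mu>])
  \<comment> \<open>Otherwise separation at a level \<open>S\<close> strictly between \<open>d\<close> and \<open>T\<close> would give a dual pair
    of value at least \<open>S > d\<close>.\<close>
  have approx: "\<exists>f\<in>selections \<mu>. \<exists>(z, r)\<in>perturbed_values \<mu> C F f. norm z \<le> e \<and> r \<le> T"
    if "d < ereal T" "0 < e" for T e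
  proof (rule ccontr)
    assume far: "\<not> ?thesis"
    obtain S where S: "d < ereal S" "S < T"
      using ereal_dense2[OF \<open>d < ereal T\<close>] by auto
    define e' where "e' = min e (T - S)"
    have "0 < e'" "e' \<le> e" "S + e' \<le> T" using S(2) \<open>0 < e\<close> by (auto simp: e'_def)
    moreover have False if "f \<in> selections \<mu>" "(z, r) \<in> perturbed_values \<mu> C F f" "norm z \<le> e'" "r \<le> S + e'" for f z r
      using far that calculation by force
    ultimately obtain \<psi> where "ereal S \<le> ereal (\<integral>x. (MIN j. C x $ j + \<psi> $ j) \<partial>\<mu>) - legendre F \<psi>"
      using separation_multiplier[OF C_meas C_le \<open>convex_fun F\<close> assms(5) \<open>proper_fun F\<close>
          \<open>eff_dom F \<subseteq> prob_simplex\<close>, of e' S] by blast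
    also have "\<dots> \<le> d"
      using reduced_dual_value_le_SUP[OF c_nth] unfolding d_def C_def by simp
    finally show False using S(1) by simp
  qed
  obtain f where f: "f \<in> selections \<mu>"
    and f_le: "ereal (\<integral>x. C x \<bullet> f x \<partial>\<mu>) + F (\<integral>x. f x \<partial>\<mu>) \<le> d"
  proof (cases "d = \<infinity>")
    case True
    obtain lam where "F lam \<noteq> \<infinity>" using \<open>proper_fun F\<close> by (auto simp: proper_fun_def)
    then have "lam \<in> prob_simplex" using \<open>eff_dom F \<subseteq> prob_simplex\<close> by (auto simp: eff_dom_def)
    then show thesis using that[OF const_selection] True by simp
  next
    case False
    then obtain T where T: "decseq T" "\<And>k. d < ereal (T k)"
      and T_lim: "\<And>x. (\<And>k. x \<le> ereal (T k)) \<Longrightarrow> x \<le> d"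
      using ereal_approx_from_above by blast
    have "\<exists>f\<in>selections \<mu>. \<exists>(z, r)\<in>perturbed_values \<mu> C F f. norm z \<le> 1 / real (Suc k) \<and> r \<le> T k" for k
      using T(2) by (intro approx) auto
    then obtain f where "f \<in> selections \<mu>"
      and "\<And>k. ereal (\<integral>x. C x \<bullet> f x \<partial>\<mu>) + F (\<integral>x. f x \<partial>\<mu>) \<le> ereal (T k)"
      using approximate_values_attained[OF C_meas C_le \<open>closed_fun F\<close> \<open>convex_fun F\<close> T(1)] by blast
    then show thesis using T_lim by (intro that) auto
  qed
  define p where "p = ((\<integral>x. f x \<partial>\<mu>), coupling_of_selection \<mu> y f)"
  have p: "p \<in> primal_feasible \<mu> y"
    using coupling_of_selection_in_couplings[OF \<mu> f] integral_selection_in_simplex[OF f]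
    by (auto simp: p_def primal_feasible_def)
  have "primal_cost c F p \<le> d"
    using f_le integral_coupling_of_selection[OF \<mu> f
        borel_measurable_continuous_on_restrict[OF \<open>continuous_on (X \<times> range y) c\<close>] assms(11)] C_meas
    by (simp add: p_def primal_cost_def C_def[abs_def])
  moreover have weak: "d \<le> primal_cost c F p'" if "p' \<in> primal_feasible \<mu> y" for p'
    unfolding d_def
    using weak_duality[OF \<open>inj y\<close> \<open>compact X\<close> \<mu> assms(5) \<open>continuous_on (X \<times> range y) c\<close> that]
    by (intro SUP_least)
  ultimately have "primal_cost c F p = d" using p by (intro antisym)
  then show ?thesis
    using p weak unfolding d_def[symmetric] is_arg_min_def by (metis not_le)
qed

end
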